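(* For every positive integer $n$, $f^{(3)}(n;6,4)\le \frac{3}{14}n^2$.
   Context: A $3$-graph is a $3$-uniform hypergraph (a finite vertex set together with a set of distinct $3$-element subsets, called edges). $f^{(3)}(n;k,s)$ denotes the maximum number of edges of a $3$-graph on $n$ vertices in which there are no $s$ distinct edges whose union contains at most $k$ vertices. (For $n\ge k$ this is the same as containing no, not necessarily induced, subgraph with exactly $k$ vertices and $s$ edges, isolated vertices being allowed.) *)

theory Defs
  imports Complex_Main
begin

definition three_graph :: "'a set \<Rightarrow> 'a set set \<Rightarrow> bool" where
  "three_graph V E \<longleftrightarrow> finite V \<and> (\<forall>e\<in>E. e \<subseteq> V \<and> card e = 3)"

definition config_free :: "nat \<Rightarrow> nat \<Rightarrow> 'a set set \<Rightarrow> bool" where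
  "config_free k s E \<longleftrightarrow> \<not> (\<exists>F\<subseteq>E. card F = s \<and> card (\<Union>F) \<le> k)"

text \<open>Since only isomorphism types matter, the vertex set is taken to be \<open>{..<n}\<close>;
  lemma \<open>card_le_f3\<close> confirms that the bound applies to every vertex set of size \<open>n\<close>.
  The maximum is over a nonempty set as soon as \<open>s > 0\<close>
  (the edgeless graph is then admissible).\<close>

definition f3 :: "nat \<Rightarrow> nat \<Rightarrow> nat \<Rightarrow> nat" where
  "f3 n k s = Max {card E | E. three_graph {..<n} E \<and> config_free k s E}"

lemma f3_finite:
  fixes n :: nat
  shows "finite {card E | E. three_graph {..<n} E \<and> config_free k s E}"
proof -
  have "{card E | E. three_graph {..<n} E \<and> config_free k s E} \<subseteq> card ` Pow (Pow {..<n})"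
    by (auto simp: three_graph_def)
  then show ?thesis
    by (rule finite_subset) simp
qed

lemma f3_nonempty:
  fixes n :: nat
  assumes "s > 0"
  shows "{card E | E. three_graph {..<n} E \<and> config_free k s E} \<noteq> {}"
proof -
  have "three_graph {..<n} {} \<and> config_free k s ({} :: nat set set)"
    using assms by (auto simp: three_graph_def config_free_def)
  then show ?thesis by blast
qed

lemma f3_attained:
  assumes "s > 0"
  obtains E where "three_graph {..<n} E" "config_free k s E" "card E = f3 n k s"
  using Max_in[OF f3_finite f3_nonempty[OF assms], of n k] unfolding f3_def by auto

lemma card_le_f3:
  assumes E: "three_graph V E" "config_free k s E" and V: "card V = n"
  shows "card E \<le> f3 n k s"
proof -
  have finV: "finite V" using E by (simp add: three_graph_def)
  then obtain h where h: "bij_betw h V {..<n}"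
    using V ex_bij_betw_finite_nat[of V] by (auto simp: atLeast0LessThan)
  have inj: "inj_on h V" and im: "h ` V = {..<n}"
    using h by (auto simp: bij_betw_def)
  have sub: "E \<subseteq> Pow V" using E(1) by (auto simp: three_graph_def)
  have injI: "inj_on ((`) h) E"
    using inj sub inj_on_image_Pow inj_on_subset by blast
  let ?E = "(`) h ` E"
  have tg: "three_graph {..<n} ?E"
    unfolding three_graph_def
  proof (intro conjI ballI)
    fix e assume "e \<in> ?E"
    then obtain d where d: "d \<in> E" "e = h ` d" by blast
    then have dV: "d \<subseteq> V" "card d = 3" using E(1) by (auto simp: three_graph_def)
    then show "e \<subseteq> {..<n}" using d im by blast
    show "card e = 3" using d dV inj by (metis card_image inj_on_subset)
  qed simp
  have "config_free k s ?E"
    unfolding config_free_def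
  proof
    assume "\<exists>F\<subseteq>?E. card F = s \<and> card (\<Union>F) \<le> k"
    then obtain G where G: "G \<subseteq> E" "card ((`) h ` G) = s" "card (\<Union>((`) h ` G)) \<le> k"
      by (metis subset_imageE)
    have "card G = s" using G injI by (metis card_image inj_on_subset)
    moreover have "card (\<Union>G) = card (\<Union>((`) h ` G))"
    proof -
      have "\<Union>((`) h ` G) = h ` \<Union>G" by auto
      moreover have "inj_on h (\<Union>G)" using inj sub G(1) by (auto intro: inj_on_subset)
      ultimately show ?thesis by (simp add: card_image)
    qed
    ultimately show False using G E(2) by (auto simp: config_free_def)
  qed
  with tg have "card ?E \<le> f3 n k s"
    unfolding f3_def by (intro Max_ge f3_finite) blast
  then show ?thesis using injI by (simp add: card_image)
qed

end

(* Call two edges adjacent if they share a pair of vertices. Three edges spanning at most 5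
   vertices admit no further edge meeting their union in two vertices, so every connected
   component of the adjacency relation has at most 3 edges, and distinct components cover
   disjoint sets of pairs. A component of 1, 2 or 3 edges covers at least 3, 5 or 7 pairs,
   unless it consists of 3 edges on 4 vertices. Hence, without the latter configuration,
   7/3 |E| is at most the number of pairs. Three edges on 4 vertices are disjoint from all
   other edges, so these 4 vertices can be deleted and induction on the number of vertices
   applies. *)

theory Submission imports Defs begin

definition shadow :: "'a set set \<Rightarrow> 'a set set" where
  "shadow E = {p. card p = 2 \<and> (\<exists>e\<in>E. p \<subseteq> e)}"

lemma shadow_Un: "shadow (E \<union> F) = shadow E \<union> shadow F"
  by (auto simp: shadow_def)

lemma shadow_insert: "shadow (insert e E) = shadow {e} \<union> shadow E"
  by (auto simp: shadow_def)

lemma shadow_subset: "three_graph V E \<Longrightarrow> shadow E \<subseteq> {p. p \<subseteq> V \<and> card p = 2}"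
  by (auto simp: shadow_def three_graph_def)

lemma finite_shadow: "three_graph V E \<Longrightarrow> finite (shadow E)"
  by (rule finite_subset[OF shadow_subset]) (auto simp: three_graph_def)

lemma finite_three_graph: "three_graph V E \<Longrightarrow> finite E"
  by (rule finite_subset[of _ "Pow V"]) (auto simp: three_graph_def)

lemma three_graph_subset: "three_graph V E \<Longrightarrow> F \<subseteq> E \<Longrightarrow> three_graph V F"
  by (auto simp: three_graph_def)

lemma config_free_subset: "config_free k s E \<Longrightarrow> F \<subseteq> E \<Longrightarrow> config_free k s F"
  by (auto simp: config_free_def)

lemma card_shadow_single:
  assumes "card e = 3"
  shows "card (shadow {e}) = 3"
proof -
  have "finite e" using assms card.infinite by fastforce
  moreover have "shadow {e} = {p. p \<subseteq> e \<and> card p = 2}" by (auto simp: shadow_def)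
  ultimately show ?thesis using n_subsets[of e 2] assms by (simp add: numeral_eq_Suc)
qed

text \<open>A pair in both shadows lies in \<open>e \<inter> \<Union>F\<close>, which has at most
  two elements, so it is that set itself. Hence at most one of the three pairs of \<open>e\<close>
  is already covered.\<close>

lemma card_shadow_insert_ge:
  assumes "card e = 3" "finite (\<Union>F)" "finite (shadow F)" "card (e \<inter> \<Union>F) \<le> 2"
  shows "card (shadow F) + 2 \<le> card (shadow (insert e F))"
proof -
  have fe: "finite e" using assms(1) card.infinite by fastforce
  have fs: "finite (shadow {e})" using card_shadow_single[OF assms(1)] card.infinite by fastforce
  have "shadow {e} \<inter> shadow F \<subseteq> {e \<inter> \<Union>F}"
  proof
    fix p assume p: "p \<in> shadow {e} \<inter> shadow F"
    then have "p \<subseteq> e \<inter> \<Union>F" "card p = 2" by (auto simp: shadow_def)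
    then have "p = e \<inter> \<Union>F" using assms(4) fe by (intro card_seteq) auto
    then show "p \<in> {e \<inter> \<Union>F}" by simp
  qed
  then have "card (shadow {e} \<inter> shadow F) \<le> 1"
    using card_mono[of "{e \<inter> \<Union>F}"] by simp
  moreover have "card (shadow {e}) + card (shadow F)
      = card (shadow (insert e F)) + card (shadow {e} \<inter> shadow F)"
    using card_Un_Int[OF fs assms(3)] by (simp add: shadow_insert[of e F])
  ultimately show ?thesis using card_shadow_single[OF assms(1)] by linarith
qed

lemma shadow_disjointI:
  assumes "\<And>e f. e \<in> E \<Longrightarrow> f \<in> F \<Longrightarrow> finite e \<and> card (e \<inter> f) \<le> 1"
  shows "shadow E \<inter> shadow F = {}"
proof (rule ccontr)
  assume "shadow E \<inter> shadow F \<noteq> {}"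
  then obtain p e f where p: "card p = 2" "e \<in> E" "p \<subseteq> e" "f \<in> F" "p \<subseteq> f"
    by (auto simp: shadow_def)
  then have "card p \<le> card (e \<inter> f)" using assms[of e f] by (intro card_mono) auto
  with assms[of e f] p show False by simp
qed

text \<open>If \<open>h\<close> met \<open>\<Union>F\<close> in \<open>t\<close> or more vertices,
  adding it to \<open>F\<close> would give \<open>Suc r\<close> edges on at most
  \<open>m + 3 - t\<close> vertices. The free parameters allow one argument to serve three
  situations: \<open>t = 3\<close>, \<open>t = 2\<close> and \<open>t = 1\<close>.\<close>

lemma config_free_card_Int:
  assumes cf: "config_free (m + 3 - t) (Suc r) E"
    and F: "F \<subseteq> E" "card F = r" "finite F" "card (\<Union>F) \<le> m" "finite (\<Union>F)"
    and h: "h \<in> E" "h \<notin> F" "card h = 3"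
  shows "card (h \<inter> \<Union>F) < t"
proof (rule ccontr)
  assume t: "\<not> card (h \<inter> \<Union>F) < t"
  have fh: "finite h" using h(3) card.infinite by fastforce
  have "card h + card (\<Union>F) = card (h \<union> \<Union>F) + card (h \<inter> \<Union>F)"
    by (rule card_Un_Int[OF fh F(5)])
  then have "card (\<Union>(insert h F)) \<le> m + 3 - t" using t F h by simp
  moreover have "card (insert h F) = Suc r" using F h by simp
  ultimately show False using cf F(1) h(1) unfolding config_free_def by blast
qed

text \<open>\<open>F\<close> is the adjacency component of \<open>e\<close>.\<close>

lemma obtain_separated_edges:
  assumes tg: "three_graph V E" and c64: "config_free 6 4 E" and c43: "config_free 4 3 E"
    and e: "e \<in> E"
  obtains F where "F \<subseteq> E" "e \<in> F" "shadow F \<inter> shadow (E - F) = {}"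
    "7 * card F \<le> 3 * card (shadow F)"
proof -
  have c3: "card x = 3" and fin: "finite x" if "x \<in> E" for x
    using tg that by (auto simp: three_graph_def intro: finite_subset)
  have fsh: "finite (shadow F)" if "F \<subseteq> E" for F
    using finite_shadow three_graph_subset[OF tg that] by blast
  show ?thesis
  proof (cases "\<exists>f\<in>E. f \<noteq> e \<and> card (e \<inter> f) \<ge> 2")
    case False
    \<comment> \<open>No edge is adjacent to \<open>e\<close>, so \<open>e\<close> forms a component
      alone, and 7 * 1 \<le> 3 * 3.\<close>
    have "shadow {e} \<inter> shadow (E - {e}) = {}"
      using False fin e by (intro shadow_disjointI) force
    then show ?thesis using that[of "{e}"] e card_shadow_single[OF c3[OF e]] by simp
  next
    case True
    then obtain f where f: "f \<in> E" "f \<noteq> e" "card (e \<inter> f) \<ge> 2" by blast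
    have ef: "card e + card f = card (e \<union> f) + card (e \<inter> f)"
      using card_Un_Int fin e f by blast
    then have U4: "card (e \<union> f) \<le> 4" using c3 e f by simp
    have i2: "card (e \<inter> f) \<le> 2"
    proof (rule ccontr)
      assume "\<not> card (e \<inter> f) \<le> 2"
      then have "e \<inter> f = e" "e \<inter> f = f"
        using card_seteq[of e "e \<inter> f"] card_seteq[of f "e \<inter> f"] fin c3 e f by auto
      then show False using f(2) by auto
    qed
    \<comment> \<open>Five pairs suffice if no third edge is adjacent to \<open>e\<close> or
      \<open>f\<close>: 7 * 2 \<le> 3 * 5.\<close>
    have s2: "card (shadow {e, f}) \<ge> 5"
      using card_shadow_insert_ge[of e "{f}"] card_shadow_single[OF c3[OF f(1)]]
        c3 e f fin i2 fsh[of "{f}"] by simp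
    show ?thesis
    proof (cases "\<exists>g\<in>E. g \<notin> {e, f} \<and> (card (e \<inter> g) \<ge> 2 \<or> card (f \<inter> g) \<ge> 2)")
      case False
      have "shadow {e, f} \<inter> shadow (E - {e, f}) = {}"
        using False fin e f by (intro shadow_disjointI) force
      then show ?thesis using that[of "{e, f}"] e f s2 by simp
    next
      case True
      then obtain g where g: "g \<in> E" "g \<noteq> e" "g \<noteq> f"
          "card (e \<inter> g) \<ge> 2 \<or> card (f \<inter> g) \<ge> 2" by blast
      have "card (e \<inter> g) \<le> card (g \<inter> (e \<union> f))" "card (f \<inter> g) \<le> card (g \<inter> (e \<union> f))"
        using fin[OF g(1)] by (auto intro!: card_mono)
      then have g2: "card (g \<inter> (e \<union> f)) \<ge> 2" using g(4) by linarith
      \<comment> \<open>Otherwise \<open>g\<close> would lie inside the at most four vertices of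
        \<open>e \<union> f\<close>, giving three edges on four vertices, which \<open>c43\<close>
        forbids.\<close>
      have "card (g \<inter> \<Union>{e, f}) < 3"
        using config_free_card_Int[of 4 3 2 E "{e, f}" g] c43 e f g U4 c3 fin by simp
      then have "card (shadow {e, f}) + 2 \<le> card (shadow {g, e, f})"
        using c3 fin e f g fsh[of "{e, f}"] by (intro card_shadow_insert_ge) auto
      \<comment> \<open>The tight case, 7 * 3 = 3 * 7, which fixes the ratio 3/7.\<close>
      then have s3: "card (shadow {g, e, f}) \<ge> 7" using s2 by simp
      have "card g + card (e \<union> f) = card (g \<union> (e \<union> f)) + card (g \<inter> (e \<union> f))"
        using card_Un_Int[of g "e \<union> f"] fin e f g by simp
      then have U5: "card (g \<union> (e \<union> f)) \<le> 5" using g2 U4 c3[OF g(1)] by simp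
      \<comment> \<open>The component stops growing here: an edge sharing two vertices with these at
        most five would give four edges on at most 5 + 3 - 2 = 6 vertices.\<close>
      have "shadow {g, e, f} \<inter> shadow (E - {g, e, f}) = {}"
      proof (rule shadow_disjointI)
        fix x h assume x: "x \<in> {g, e, f}" and h: "h \<in> E - {g, e, f}"
        have "card (h \<inter> \<Union>{g, e, f}) < 2"
          using config_free_card_Int[of 5 2 3 E "{g, e, f}" h] c64 e f g h U5 c3 fin by simp
        moreover have "card (x \<inter> h) \<le> card (h \<inter> \<Union>{g, e, f})"
          using x h fin by (intro card_mono) auto
        ultimately show "finite x \<and> card (x \<inter> h) \<le> 1" using x fin e f g by auto
      qed
      then show ?thesis using that[of "{g, e, f}"] e f g s3 by simp
    qed
  qed
qed

text \<open>Components are peeled off one at a time. Their shadows are disjoint from the rest, so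
  the estimates add up, and all hypotheses pass to \<open>E - F\<close>.\<close>

lemma card_le_card_shadow:
  assumes "three_graph V E" "config_free 6 4 E" "config_free 4 3 E"
  shows "7 * card E \<le> 3 * card (shadow E)"
  using assms
proof (induction "card E" arbitrary: E rule: less_induct)
  case less
  show ?case
  proof (cases "E = {}")
    case False
    then obtain e where "e \<in> E" by blast
    then obtain F where F: "F \<subseteq> E" "e \<in> F" "shadow F \<inter> shadow (E - F) = {}"
        "7 * card F \<le> 3 * card (shadow F)"
      using obtain_separated_edges less.prems by blast
    have fE: "finite E" by (rule finite_three_graph[OF less.prems(1)])
    have "card (E - F) < card E" using F fE by (intro psubset_card_mono) auto
    moreover have "E - F \<subseteq> E" by blast
    ultimately have IH: "7 * card (E - F) \<le> 3 * card (shadow (E - F))"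
      using less three_graph_subset config_free_subset by metis
    have "finite (shadow F)" "finite (shadow (E - F))"
      using finite_shadow three_graph_subset less.prems(1) F(1) Diff_subset by metis+
    then have "card (shadow F) + card (shadow (E - F)) = card (shadow (F \<union> (E - F)))"
      using F(3) by (simp only: shadow_Un card_Un_disjoint)
    moreover have "F \<union> (E - F) = E" using F(1) by blast
    moreover have "card E = card F + card (E - F)"
      using F(1) fE by (metis card_Diff_subset card_mono finite_subset le_add_diff_inverse)
    ultimately show ?thesis using IH F(4) by simp
  qed simp
qed

text \<open>Three edges on four vertices cover only 6 pairs, and 7 * 3 > 3 * 6, so the count of
  pairs fails for them. The vertex set is arbitrary because the induction deletes such a
  quadruple.\<close>

lemma card_le_of_config_free_6_4:
  assumes "three_graph V E" "config_free 6 4 E"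
  shows "14 * card E \<le> 3 * (card V)\<^sup>2"
  using assms
proof (induction "card V" arbitrary: V E rule: less_induct)
  case less
  note tg = less.prems(1) and c64 = less.prems(2)
  have fV: "finite V" using tg by (simp add: three_graph_def)
  have fE: "finite E" by (rule finite_three_graph[OF tg])
  show ?case
  proof (cases "config_free 4 3 E")
    case True
    have "card (shadow E) \<le> card {p. p \<subseteq> V \<and> card p = 2}"
      using shadow_subset[OF tg] fV by (intro card_mono) auto
    also have "\<dots> = card V choose 2" by (rule n_subsets[OF fV])
    finally have "2 * card (shadow E) \<le> card V * (card V - 1)" by (simp add: choose_two)
    \<comment> \<open>Discarding the linear term turns 3/7 of the number of pairs into 3/14 of the
      square.\<close>
    also have "\<dots> \<le> (card V)\<^sup>2" by (simp add: power2_eq_square)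
    finally show ?thesis using card_le_card_shadow[OF tg c64 True] by linarith
  next
    case False
    then obtain F where F: "F \<subseteq> E" "card F = 3" "card (\<Union>F) \<le> 4"
      unfolding config_free_def by blast
    let ?U = "\<Union>F"
    have UV: "?U \<subseteq> V" using F(1) tg by (auto simp: three_graph_def)
    have fU: "finite ?U" using UV fV finite_subset by blast
    \<comment> \<open>Fewer than four vertices carry at most one triple, so \<open>?U\<close> has
      exactly four.\<close>
    have "F \<subseteq> {e. e \<subseteq> ?U \<and> card e = 3}" using F(1) tg by (auto simp: three_graph_def)
    then have "card F \<le> card {e. e \<subseteq> ?U \<and> card e = 3}"
      using fU by (intro card_mono) auto
    then have "3 \<le> card ?U choose 3" using F(2) n_subsets[OF fU, of 3] by simp
    then have "card ?U \<noteq> 3" "\<not> card ?U < 3" by (auto simp: binomial_eq_0)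
    then have U4: "card ?U = 4" using F(3) by simp
    \<comment> \<open>An edge touching \<open>?U\<close> would complete four edges on at most 4 + 3
      - 1 = 6 vertices.\<close>
    have dis: "h \<inter> ?U = {}" if "h \<in> E - F" for h
    proof -
      have "card h = 3" using that tg by (simp add: three_graph_def)
      then have "card (h \<inter> ?U) < 1"
        using config_free_card_Int[of 4 1 3 E F h] c64 F fU that finite_subset[OF F(1) fE]
        by simp
      then show ?thesis using fU by simp
    qed
    have tg': "three_graph (V - ?U) (E - F)"
      using tg dis fV unfolding three_graph_def by blast
    have cV: "card V = card (V - ?U) + 4"
      using card_Diff_subset[OF fU UV] card_mono[OF fV UV] U4 by simp
    then have IH: "14 * card (E - F) \<le> 3 * (card (V - ?U))\<^sup>2"
      using less.hyps[OF _ tg'] config_free_subset[OF c64] by simp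
    have "card E = card (E - F) + 3"
      using card_Diff_subset[OF finite_subset[OF F(1) fE] F(1)] card_mono[OF fE F(1)] F(2) by simp
    \<comment> \<open>With m = \<open>card (V - ?U)\<close>, the left side grows by 14 * 3 = 42 and
      the right side by 3 * (8 * m + 16) \<ge> 48.\<close>
    then show ?thesis using IH unfolding cV by (simp add: power2_eq_square algebra_simps)
  qed
qed

theorem theorem7:
  fixes n :: nat
  assumes "n > 0"
  shows "real (f3 n 6 4) \<le> 3 / 14 * (real n)\<^sup>2"
proof -
  obtain E where E: "three_graph {..<n} E" "config_free 6 4 E" "card E = f3 n 6 4"
    using f3_attained[of 4 n 6] by auto
  then have "14 * f3 n 6 4 \<le> 3 * n\<^sup>2"
    using card_le_of_config_free_6_4[OF E(1,2)] by simp
  then have "real (14 * f3 n 6 4) \<le> real (3 * n\<^sup>2)" by (rule of_nat_mono)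
  then show ?thesis by simp
qed

end
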